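(* Let $G$ be a finite primitive unitary reflection group of rank at least 2 and let $P$ be a parabolic subgroup of $G$ of rank 1. Then $N_G(P)=C_G(P)$.
   Context: $V$ is a finite-dimensional complex vector space with a positive definite Hermitian form. A reflection is a finite-order linear map whose fixed space is a hyperplane; a unitary reflection group is a finite group of form-preserving linear maps of $V$ generated by reflections; its rank is $\dim V$. $G$ is primitive if there is no decomposition $V=V_1\oplus\cdots\oplus V_k$, $k>1$, into non-zero subspaces permuted by $G$. A parabolic subgroup is the pointwise stabiliser in $G$ of a subset of $V$; its rank is the codimension of its fixed point space. A rank 1 parabolic subgroup is cyclic, generated by a single reflection. *)

theory Defs
  imports "HOL-Analysis.Analysis"
begin

text \<open>V = complex^'n with the standard positive definite Hermitian form;
  linear maps of V are represented by matrices acting via *v.\<close>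

definition adjoint_mat :: "complex^'n^'n \<Rightarrow> complex^'n^'n" where
  "adjoint_mat A = (\<chi> i j. cnj (A $ j $ i))"

definition unitary_mat :: "complex^'n^'n \<Rightarrow> bool" where
  "unitary_mat A \<longleftrightarrow> A ** adjoint_mat A = mat 1 \<and> adjoint_mat A ** A = mat 1"

definition mat_power :: "complex^'n^'n \<Rightarrow> nat \<Rightarrow> complex^'n^'n" where
  "mat_power A k = ((\<lambda>B. A ** B) ^^ k) (mat 1)"

definition fixed_space :: "(complex^'n^'n) set \<Rightarrow> (complex^'n) set" where
  "fixed_space S = {v. \<forall>g\<in>S. g *v v = v}"

text \<open>A reflection: a finite-order linear map whose fixed space is a hyperplane.\<close>
definition is_reflection :: "complex^'n^'n \<Rightarrow> bool" where
  "is_reflection A \<longleftrightarrow> (\<exists>k>0. mat_power A k = mat 1)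
      \<and> vec.dim (fixed_space {A}) = CARD('n) - 1"

text \<open>Subgroup of GL(V) generated by a set of matrices.\<close>
inductive_set mat_gen :: "(complex^'n^'n) set \<Rightarrow> (complex^'n^'n) set" for S where
  one: "mat 1 \<in> mat_gen S"
| mul: "s \<in> S \<Longrightarrow> g \<in> mat_gen S \<Longrightarrow> s ** g \<in> mat_gen S"
| mulinv: "s \<in> S \<Longrightarrow> g \<in> mat_gen S \<Longrightarrow> matrix_inv s ** g \<in> mat_gen S"

text \<open>A finite group of unitary maps generated by reflections.\<close>
definition unitary_reflection_group :: "(complex^'n^'n) set \<Rightarrow> bool" where
  "unitary_reflection_group G \<longleftrightarrow> finite G \<and> (\<forall>g\<in>G. unitary_mat g)
     \<and> (\<exists>R. (\<forall>r\<in>R. is_reflection r) \<and> G = mat_gen R)"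

text \<open>Imprimitivity system: decomposition V = V_1 + ... + V_k, k > 1, into nonzero
  subspaces permuted by G.\<close>
definition imprimitivity_system :: "(complex^'n^'n) set \<Rightarrow> (complex^'n) set set \<Rightarrow> bool" where
  "imprimitivity_system G W \<longleftrightarrow> finite W \<and> card W > 1
     \<and> (\<forall>U\<in>W. vec.subspace U \<and> U \<noteq> {0})
     \<and> vec.span (\<Union>W) = UNIV
     \<and> (\<forall>U\<in>W. U \<inter> vec.span (\<Union>(W - {U})) = {0})
     \<and> (\<forall>g\<in>G. \<forall>U\<in>W. ((*v) g) ` U \<in> W)"

definition primitive :: "(complex^'n^'n) set \<Rightarrow> bool" where
  "primitive G \<longleftrightarrow> \<not> (\<exists>W. imprimitivity_system G W)"

definition pointwise_stabiliser :: "(complex^'n^'n) set \<Rightarrow> (complex^'n) set \<Rightarrow> (complex^'n^'n) set" where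
  "pointwise_stabiliser G X = {g\<in>G. \<forall>x\<in>X. g *v x = x}"

definition parabolic_subgroup :: "(complex^'n^'n) set \<Rightarrow> (complex^'n^'n) set \<Rightarrow> bool" where
  "parabolic_subgroup G P \<longleftrightarrow> (\<exists>X. P = pointwise_stabiliser G X)"

definition parabolic_rank :: "(complex^'n^'n) set \<Rightarrow> nat" where
  "parabolic_rank P = CARD('n) - vec.dim (fixed_space P)"

definition normaliser :: "(complex^'n^'n) set \<Rightarrow> (complex^'n^'n) set \<Rightarrow> (complex^'n^'n) set" where
  "normaliser G P = {g\<in>G. (\<lambda>h. g ** h ** matrix_inv g) ` P = P}"

definition centraliser :: "(complex^'n^'n) set \<Rightarrow> (complex^'n^'n) set \<Rightarrow> (complex^'n^'n) set" where
  "centraliser G P = {g\<in>G. \<forall>h\<in>P. g ** h = h ** g}"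

end

theory Submission
  imports Defs
begin

text \<open>Every element h of P fixes the hyperplane H = Fix(P) pointwise and therefore acts on V/H
  by a scalar. An element g of the normaliser preserves H, so g h g\<inverse> is again in P and acts on
  V/H by the same scalar. A unitary map fixing H pointwise is determined by that scalar: if h, h'
  are two such maps, then h\<inverse>h' is unitary and h\<inverse>h' - 1 maps V into H and kills H, so it
  squares to zero, and a unitary map U with (U - 1)^2 = 0 is the identity. Hence g h g\<inverse> = h.\<close>

lemma subspace_fixed_space: "vec.subspace (fixed_space S)"
  unfolding vec.subspace_def fixed_space_def
  by (auto simp: matrix_vector_right_distrib vector_scalar_commute)

lemma fixing_hyperplane_acts_by_scalar_mod:
  fixes h :: "complex^'n^'n"
  assumes H: "vec.subspace H" and dim: "vec.dim H = CARD('n) - 1"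
    and fixes_H: "\<And>v. v \<in> H \<Longrightarrow> h *v v = v"
  shows "\<exists>c. \<forall>w. h *v w - c *s w \<in> H"
proof (cases "H = UNIV")
  case True
  then show ?thesis by auto
next
  case False
  then obtain u where u: "u \<notin> H" by auto
  have span_H: "vec.span H = H" using H by simp
  have "vec.span H \<subset> vec.span (insert u H)"
    using u span_H by (metis insertI1 subset_insertI vec.span_base vec.span_mono psubsetI)
  then have "vec.dim H < vec.dim (insert u H)"
    by (metis vec.dim_psubset)
  moreover have "vec.dim (insert u H) \<le> CARD('n)" by (rule dim_subset_UNIV_cart_gen)
  ultimately have "vec.dim (insert u H) = CARD('n)" using dim by linarith
  then have "vec.span (insert u H) = UNIV"
    by (metis vec.dim_eq_full vec.span_UNIV vec_dim_card)
  then have decomp: "\<exists>k. x - k *s u \<in> H" for x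
    using span_H by (auto simp: vec.span_insert)
  obtain c where c: "h *v u - c *s u \<in> H" using decomp by blast
  show ?thesis
  proof (intro exI allI)
    fix w
    obtain k where k: "w - k *s u \<in> H" using decomp by blast
    define b where "b = w - k *s u"
    have w: "w = b + k *s u" using b_def by simp
    have "h *v b = b" using fixes_H k b_def by simp
    then have "h *v w - c *s w = k *s (h *v u - c *s u) + (b - c *s b)"
      unfolding w by (simp add: vector_scalar_commute algebra_simps)
    moreover have "k *s (h *v u - c *s u) \<in> H" using c H vec.subspace_scale by blast
    moreover have "b - c *s b \<in> H" using k b_def H vec.subspace_diff vec.subspace_scale by blast
    ultimately show "h *v w - c *s w \<in> H" using H vec.subspace_add by metis
  qed
qed

lemma adjoint_mat_mult: "adjoint_mat (A ** B) = adjoint_mat B ** (adjoint_mat A :: complex^'n^'n)"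
  by (simp add: adjoint_mat_def matrix_matrix_mult_def vec_eq_iff mult.commute)

lemma adjoint_mat_adjoint_mat [simp]: "adjoint_mat (adjoint_mat A) = (A :: complex^'n^'n)"
  by (simp add: adjoint_mat_def vec_eq_iff)

lemma adjoint_mat_add: "adjoint_mat (A + B) = adjoint_mat A + (adjoint_mat B :: complex^'n^'n)"
  by (simp add: adjoint_mat_def vec_eq_iff)

lemma adjoint_mat_mat_1 [simp]: "adjoint_mat (mat 1) = (mat 1 :: complex^'n^'n)"
  by (simp add: adjoint_mat_def vec_eq_iff mat_def)

lemma adjoint_mat_mult_self_eq_0:
  fixes A :: "complex^'n^'n"
  assumes "adjoint_mat A ** A = 0"
  shows "A = 0"
  unfolding vec_eq_iff
proof (intro allI)
  fix i j
  have "(adjoint_mat A ** A) $ j $ j = (\<Sum>k\<in>UNIV. cnj (A$k$j) * A$k$j)"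
    by (simp add: adjoint_mat_def matrix_matrix_mult_def)
  also have "\<dots> = of_real (\<Sum>k\<in>UNIV. (cmod (A$k$j))\<^sup>2)"
    unfolding of_real_sum by (intro sum.cong refl) (simp only: complex_norm_square mult.commute)
  finally have "(\<Sum>k\<in>UNIV. (cmod (A$k$j))\<^sup>2) = 0"
    using assms by (metis of_real_eq_0_iff zero_index)
  then have "(cmod (A$i$j))\<^sup>2 = 0"
    by (subst (asm) sum_nonneg_eq_0_iff) auto
  then show "A $ i $ j = 0 $ i $ j" by simp
qed

lemma matrix_add_rdistrib: "(A + B) ** C = A ** C + B ** (C :: complex^'n^'n)"
  by (simp add: matrix_matrix_mult_def vec_eq_iff distrib_right sum.distrib)

text \<open>Writing U = 1 + N, unitarity reads N^* N + N + N^* = 0; multiplying on the right by N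
  and using N^2 = 0 leaves N^* N = 0.\<close>
lemma unitary_mat_square_zero_perturbation:
  fixes N :: "complex^'n^'n"
  assumes square_zero: "N ** N = 0"
    and unitary: "adjoint_mat (N + mat 1) ** (N + mat 1) = mat 1"
  shows "N = 0"
proof -
  have "adjoint_mat N ** N + adjoint_mat N + N = 0"
    using unitary by (simp add: adjoint_mat_add matrix_add_ldistrib matrix_add_rdistrib algebra_simps)
  moreover have "(adjoint_mat N ** N + adjoint_mat N + N) ** N = adjoint_mat N ** N"
    by (simp add: matrix_add_rdistrib square_zero matrix_mul_assoc[symmetric])
  ultimately have "adjoint_mat N ** N = 0"
    by (simp add: matrix_matrix_mult_def vec_eq_iff)
  then show ?thesis by (rule adjoint_mat_mult_self_eq_0)
qed

lemma unitary_mat_matrix_inv: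
  fixes g :: "complex^'n^'n"
  assumes "unitary_mat g"
  shows "g ** matrix_inv g = mat 1 \<and> matrix_inv g ** g = mat 1"
  unfolding matrix_inv_def
  by (rule someI[of _ "adjoint_mat g"]) (use assms in \<open>simp add: unitary_mat_def\<close>)

lemma unitary_mat_adjoint_fixes:
  fixes h :: "complex^'n^'n"
  assumes "unitary_mat h" "h *v x = x"
  shows "adjoint_mat h *v x = x"
proof -
  have "adjoint_mat h *v x = (adjoint_mat h ** h) *v x"
    using assms(2) by (simp add: matrix_vector_mul_assoc[symmetric])
  also have "\<dots> = x" using assms(1) unfolding unitary_mat_def by simp
  finally show ?thesis .
qed

lemma unitary_mat_eq_if_fixing_and_congruent_mod:
  fixes h h' :: "complex^'n^'n"
  assumes H: "vec.subspace H"
    and unitary: "unitary_mat h" "unitary_mat h'"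
    and fixes_H: "\<And>v. v \<in> H \<Longrightarrow> h *v v = v" "\<And>v. v \<in> H \<Longrightarrow> h' *v v = v"
    and congruent: "\<And>v. h' *v v - h *v v \<in> H"
  shows "h' = h"
proof -
  define N where "N = adjoint_mat h ** h' - mat 1"
  have N_apply: "N *v v = adjoint_mat h *v (h' *v v - h *v v)" for v
    using unitary(1)
    by (simp add: N_def unitary_mat_def matrix_vector_mult_diff_rdistrib
        matrix_vector_mult_diff_distrib matrix_vector_mul_assoc)
  have N_into_H: "N *v v \<in> H" for v
    using N_apply congruent unitary_mat_adjoint_fixes[OF unitary(1) fixes_H(1)] by metis
  have N_kills_H: "N *v v = 0" if "v \<in> H" for v
    using N_apply[of v] fixes_H[OF that] by simp
  have "N ** N = 0"
    unfolding matrix_eq by (simp add: matrix_vector_mul_assoc[symmetric] N_kills_H[OF N_into_H])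
  moreover have "adjoint_mat (N + mat 1) ** (N + mat 1) = mat 1"
  proof -
    have "adjoint_mat (N + mat 1) ** (N + mat 1) = adjoint_mat h' ** ((h ** adjoint_mat h) ** h')"
      by (simp add: N_def adjoint_mat_mult matrix_mul_assoc)
    also have "\<dots> = mat 1" using unitary by (simp add: unitary_mat_def)
    finally show ?thesis .
  qed
  ultimately have "adjoint_mat h ** h' = mat 1"
    using unitary_mat_square_zero_perturbation unfolding N_def by fastforce
  then have "(h ** adjoint_mat h) ** h' = h" by (simp add: matrix_mul_assoc[symmetric])
  then show ?thesis using unitary(1) by (simp add: unitary_mat_def)
qed

lemma normaliser_preserves_fixed_space:
  assumes g: "g \<in> normaliser G P" "unitary_mat g" and v: "v \<in> fixed_space P"
  shows "g *v v \<in> fixed_space P"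
  unfolding fixed_space_def
proof (intro CollectI ballI)
  fix h' assume "h' \<in> P"
  then obtain h where h: "h \<in> P" "h' = g ** h ** matrix_inv g"
    using g(1) unfolding normaliser_def by force
  have "h' *v (g *v v) = g *v (h *v ((matrix_inv g ** g) *v v))"
    by (simp add: h(2) matrix_vector_mul_assoc matrix_mul_assoc)
  also have "\<dots> = g *v v"
    using unitary_mat_matrix_inv[OF g(2)] h(1) v unfolding fixed_space_def by simp
  finally show "h' *v (g *v v) = g *v v" .
qed

lemma conjugate_acts_by_same_scalar_mod:
  fixes g h :: "complex^'n^'n"
  assumes H: "vec.subspace H" and g: "unitary_mat g" and preserves: "\<And>v. v \<in> H \<Longrightarrow> g *v v \<in> H"
    and scalar: "\<And>w. h *v w - c *s w \<in> H"
  shows "(g ** h ** matrix_inv g) *v v - c *s v \<in> H"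
proof -
  have "(g ** h ** matrix_inv g) *v v - c *s v
      = g *v (h *v (matrix_inv g *v v) - c *s (matrix_inv g *v v))"
    using unitary_mat_matrix_inv[OF g]
    by (simp add: matrix_vector_mul_assoc[symmetric] matrix_vector_right_distrib
        vector_scalar_commute matrix_vector_mult_diff_distrib)
      (simp add: matrix_vector_mul_assoc)
  then show ?thesis using preserves[OF scalar] by simp
qed

lemma normaliser_eq_centraliser_if_fixed_hyperplane:
  fixes G P :: "(complex^'n^'n) set"
  assumes unitary: "\<And>g. g \<in> G \<Longrightarrow> unitary_mat g" and "P \<subseteq> G"
    and hyperplane: "vec.dim (fixed_space P) = CARD('n) - 1"
  shows "normaliser G P = centraliser G P"
proof
  let ?H = "fixed_space P"
  have fixes_H: "h *v v = v" if "h \<in> P" "v \<in> ?H" for h v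
    using that unfolding fixed_space_def by blast
  show "normaliser G P \<subseteq> centraliser G P"
  proof
    fix g assume g: "g \<in> normaliser G P"
    then have "g \<in> G" and conj: "(\<lambda>h. g ** h ** matrix_inv g) ` P = P"
      unfolding normaliser_def by auto
    then have ug: "unitary_mat g" using unitary by blast
    have "g ** h = h ** g" if h: "h \<in> P" for h
    proof -
      define h' where "h' = g ** h ** matrix_inv g"
      have h': "h' \<in> P" using conj h h'_def by blast
      obtain c where c: "\<And>w. h *v w - c *s w \<in> ?H"
        using fixing_hyperplane_acts_by_scalar_mod[OF subspace_fixed_space hyperplane] fixes_H h by blast
      have h'_scalar: "h' *v v - c *s v \<in> ?H" for v
        unfolding h'_def by (rule conjugate_acts_by_same_scalar_mod[OF subspace_fixed_space ug
              normaliser_preserves_fixed_space[OF g ug] c])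
      have "h' *v v - h *v v \<in> ?H" for v
      proof -
        have "h' *v v - h *v v = (h' *v v - c *s v) - (h *v v - c *s v)" by simp
        then show ?thesis using vec.subspace_diff[OF subspace_fixed_space h'_scalar[of v] c[of v]] by simp
      qed
      then have "h' = h"
        using unitary_mat_eq_if_fixing_and_congruent_mod[OF subspace_fixed_space,
            of h h'] unitary \<open>P \<subseteq> G\<close> h h' fixes_H by blast
      then have "h ** g = g ** h ** (matrix_inv g ** g)"
        by (simp add: h'_def matrix_mul_assoc)
      then show ?thesis using unitary_mat_matrix_inv[OF ug] by simp
    qed
    then show "g \<in> centraliser G P" unfolding centraliser_def using \<open>g \<in> G\<close> by blast
  qed
  show "centraliser G P \<subseteq> normaliser G P"
  proof
    fix g assume "g \<in> centraliser G P"
    then have "g \<in> G" and comm: "\<And>h. h \<in> P \<Longrightarrow> g ** h = h ** g"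
      unfolding centraliser_def by auto
    then have "g ** matrix_inv g = mat 1" using unitary unitary_mat_matrix_inv by blast
    then have "(\<lambda>h. g ** h ** matrix_inv g) ` P = P"
      using comm by (simp add: matrix_mul_assoc[symmetric])
    then show "g \<in> normaliser G P" unfolding normaliser_def using \<open>g \<in> G\<close> by blast
  qed
qed

theorem lemma5p1:
  fixes G P :: "(complex^'n^'n) set"
  assumes "unitary_reflection_group G"
    and "primitive G"
    and "CARD('n) \<ge> 2"
    and "parabolic_subgroup G P"
    and "parabolic_rank P = 1"
  shows "normaliser G P = centraliser G P"
proof (rule normaliser_eq_centraliser_if_fixed_hyperplane)
  show "\<And>g. g \<in> G \<Longrightarrow> unitary_mat g"
    using assms(1) unfolding unitary_reflection_group_def by blast
  show "P \<subseteq> G"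
    using assms(4) unfolding parabolic_subgroup_def pointwise_stabiliser_def by blast
  have "vec.dim (fixed_space P) \<le> CARD('n)" by (rule dim_subset_UNIV_cart_gen)
  then show "vec.dim (fixed_space P) = CARD('n) - 1"
    using assms(5) unfolding parabolic_rank_def by simp
qed

end
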